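(* Let $\Gamma$ be a lawless group generated by a finite set $S$, and let $k \geq 2$ be a fixed integer. Then $\Gamma$ has a nonabelian free subgroup if and only if the lawlessness growth function $\mathcal{A}_{\Gamma}^S : \mathbb{N} \to \mathbb{N}$ (defined using words in $F_k$) is bounded.
   Context: $\mathbb{N}=\{1,2,\dots\}$. For a group $\Gamma$ with finite generating set $S$, $|g|_S$ denotes the word length of $g\in\Gamma$ with respect to $S$ (letters from $S\cup S^{-1}$). $F_k$ is the free group on $x_1,\dots,x_k$ and $|w|$ is the reduced length of $w\in F_k$. For $w\in F_k$ and $\mathbf g=(g_1,\dots,g_k)\in\Gamma^k$, $w(\mathbf g)$ is the image of $w$ under the homomorphism $F_k\to\Gamma$, $x_i\mapsto g_i$. A law for $\Gamma$ is a nontrivial $w$ in some $F_k$ with $w(\mathbf g)=1$ for all $\mathbf g\in\Gamma^k$; $\Gamma$ is lawless if it has no laws. For $\Gamma$ lawless and $1\neq w\in F_k$, the complexity is $\chi_\Gamma^S(w)=\min\{\sum_{i=1}^k|g_i|_S : \mathbf g\in\Gamma^k,\ w(\mathbf g)\neq 1\}$, and the lawlessness growth function is $\mathcal A_\Gamma^S(n)=\max\{\chi_\Gamma^S(w) : 1\neq w\in F_k,\ |w|\le n\}$, where the rank $k\ge 2$ is fixed. *)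

theory Defs
  imports "HOL-Algebra.Generated_Groups" "HOL-Library.FuncSet"
begin

text \<open>A word is a list of letters \<open>(x, b)\<close>: the letter \<open>(x, True)\<close> stands for the generator
  \<open>x\<close>, and \<open>(x, False)\<close> for its formal inverse. The free group on \<open>X\<close> is realised on the reduced
  words over \<open>X\<close>, so that its unit is the empty word and the reduced length of an element is
  just \<open>length\<close>.\<close>

type_synonym 'x word = "('x \<times> bool) list"

fun inv_letter :: "'x \<times> bool \<Rightarrow> 'x \<times> bool" where
  "inv_letter (x, b) = (x, \<not> b)"

fun reduced :: "'x word \<Rightarrow> bool" where
  "reduced (a # b # w) \<longleftrightarrow> b \<noteq> inv_letter a \<and> reduced (b # w)"
| "reduced _ \<longleftrightarrow> True"

fun red_cons :: "'x \<times> bool \<Rightarrow> 'x word \<Rightarrow> 'x word" where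
  "red_cons a [] = [a]"
| "red_cons a (b # w) = (if b = inv_letter a then w else a # b # w)"

definition free_group :: "'x set \<Rightarrow> 'x word monoid" where
  "free_group X = \<lparr>carrier = {w. reduced w \<and> fst ` set w \<subseteq> X}, mult = foldr red_cons, one = []\<rparr>"

definition word_eval :: "('a, 'm) monoid_scheme \<Rightarrow> ('x \<Rightarrow> 'a) \<Rightarrow> 'x word \<Rightarrow> 'a" where
  "word_eval G g w =
     foldr (\<lambda>(x, b) y. (if b then g x else inv\<^bsub>G\<^esub> g x) \<otimes>\<^bsub>G\<^esub> y) w \<one>\<^bsub>G\<^esub>"

text \<open>The lemmas up to \<open>word_eval_unique\<close> show that \<open>free_group X\<close> is a group with the universal
  property of the free group on \<open>X\<close>, and that \<open>word_eval G g\<close> is the homomorphism it provides.\<close>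

lemma inv_letter_inv_letter [simp]: "inv_letter (inv_letter a) = a"
  by (cases a) simp

lemma inv_letter_neq [simp]: "inv_letter a \<noteq> a" "a \<noteq> inv_letter a"
  by (cases a; simp)+

lemma fst_inv_letter [simp]: "fst (inv_letter a) = fst a"
  by (cases a) simp

lemma reduced_ConsD: "reduced (a # w) \<Longrightarrow> reduced w"
  by (cases w) auto

lemma reduced_red_cons: "reduced w \<Longrightarrow> reduced (red_cons a w)"
  by (cases w) (auto dest: reduced_ConsD)

lemma reduced_foldr: "reduced v \<Longrightarrow> reduced (foldr red_cons u v)"
  by (induction u) (auto intro: reduced_red_cons)

lemma set_red_cons: "set (red_cons a w) \<subseteq> insert a (set w)"
  by (cases w) auto

lemma set_foldr: "set (foldr red_cons u v) \<subseteq> set u \<union> set v"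
proof (induction u)
  case (Cons a u)
  then show ?case using set_red_cons[of a "foldr red_cons u v"] by auto
qed simp

lemma red_cons_inv: "reduced w \<Longrightarrow> red_cons a (red_cons (inv_letter a) w) = w"
proof (cases w)
  case (Cons b v)
  assume "reduced w"
  then show ?thesis using Cons by (cases v) auto
qed simp

lemma red_cons_reduced: "reduced (a # w) \<Longrightarrow> red_cons a w = a # w"
  by (cases w) auto

lemma foldr_red_cons:
  assumes "reduced v"
  shows "foldr red_cons (red_cons a u) v = red_cons a (foldr red_cons u v)"
proof (cases u)
  case (Cons b w)
  have "red_cons a (red_cons (inv_letter a) (foldr red_cons w v)) = foldr red_cons w v"
    by (intro red_cons_inv reduced_foldr assms)
  then show ?thesis using Cons by auto
qed simp

lemma foldr_assoc:
  assumes "reduced w"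
  shows "foldr red_cons (foldr red_cons u v) w = foldr red_cons u (foldr red_cons v w)"
  by (induction u) (simp_all add: foldr_red_cons assms)

lemma foldr_Nil: "reduced w \<Longrightarrow> foldr red_cons w [] = w"
proof (induction w)
  case (Cons a w)
  then show ?case by (metis foldr_Cons o_apply red_cons_reduced reduced_ConsD)
qed simp

lemma reduced_snoc:
  "reduced (w @ [a]) \<longleftrightarrow> reduced w \<and> (w \<noteq> [] \<longrightarrow> a \<noteq> inv_letter (last w))"
  by (induction w rule: reduced.induct) auto

lemma reduced_inverse: "reduced w \<Longrightarrow> reduced (rev (map inv_letter w))"
proof (induction w rule: reduced.induct)
  case (1 a b w)
  then show ?case
    by (metis append_is_Nil_conv inv_letter_inv_letter last_snoc list.simps(9) reduced.simps(1)
        reduced_snoc rev.simps(2))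
qed auto

lemma foldr_inverse:
  "reduced v \<Longrightarrow> foldr red_cons (rev (map inv_letter w)) (foldr red_cons w v) = v"
proof (induction w)
  case (Cons a w)
  have "red_cons (inv_letter a) (red_cons a (foldr red_cons w v)) = foldr red_cons w v"
    using red_cons_inv[of "foldr red_cons w v" "inv_letter a"] Cons.prems reduced_foldr by auto
  then show ?case using Cons by simp
qed simp

lemma group_free_group: "group (free_group X)"
proof (rule groupI)
  fix u v assume "u \<in> carrier (free_group X)" "v \<in> carrier (free_group X)"
  then show "u \<otimes>\<^bsub>free_group X\<^esub> v \<in> carrier (free_group X)"
    using set_foldr[of u v] by (fastforce simp: free_group_def reduced_foldr)
next
  fix u assume "u \<in> carrier (free_group X)"
  then show "\<exists>v\<in>carrier (free_group X). v \<otimes>\<^bsub>free_group X\<^esub> u = \<one>\<^bsub>free_group X\<^esub>"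
    using foldr_inverse[of "[]" u]
    by (intro bexI[of _ "rev (map inv_letter u)"])
       (auto simp: free_group_def foldr_Nil reduced_inverse)
qed (auto simp: free_group_def foldr_assoc)

lemma (in group) word_eval_closed:
  assumes "g \<in> X \<rightarrow> carrier G" "fst ` set w \<subseteq> X"
  shows "word_eval G g w \<in> carrier G"
  using assms(2)
proof (induction w)
  case (Cons a w)
  then have "word_eval G g w \<in> carrier G" "g (fst a) \<in> carrier G" using assms(1) by auto
  then show ?case by (cases a) (auto simp: word_eval_def)
qed (simp add: word_eval_def)

lemma (in group) word_eval_red_cons:
  assumes "g \<in> X \<rightarrow> carrier G" "fst a \<in> X" "fst ` set w \<subseteq> X"
  shows "word_eval G g (red_cons a w) = word_eval G g (a # w)"
proof (cases w)
  case (Cons b v)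
  obtain x c where a: "a = (x, c)" by force
  have x: "g x \<in> carrier G" using assms a by auto
  have v: "word_eval G g v \<in> carrier G" using assms Cons by (intro word_eval_closed) auto
  show ?thesis using x v
    by (auto simp: Cons a word_eval_def m_assoc[symmetric])
qed simp

lemma (in group) word_eval_hom:
  assumes g: "g \<in> X \<rightarrow> carrier G"
  shows "word_eval G g \<in> hom (free_group X) G"
proof (rule homI)
  fix u assume "u \<in> carrier (free_group X)"
  then show "word_eval G g u \<in> carrier G"
    using word_eval_closed[OF g] by (simp add: free_group_def)
next
  fix u v assume u: "u \<in> carrier (free_group X)" and "v \<in> carrier (free_group X)"
  then have v: "fst ` set v \<subseteq> X" by (simp add: free_group_def)
  have "fst ` set u \<subseteq> X" using u by (simp add: free_group_def)
  then have "word_eval G g (foldr red_cons u v) = word_eval G g u \<otimes> word_eval G g v"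
  proof (induction u)
    case Nil
    then show ?case using word_eval_closed[OF g v] by (simp add: word_eval_def)
  next
    case (Cons a u)
    let ?y = "if snd a then g (fst a) else inv g (fst a)"
    have step: "word_eval G g (a # w) = ?y \<otimes> word_eval G g w" for w
      by (simp add: word_eval_def case_prod_beta)
    have y: "?y \<in> carrier G" using Cons.prems g by auto
    have "fst ` set (foldr red_cons u v) \<subseteq> X"
      using set_foldr[of u v] v Cons.prems by fastforce
    then have "word_eval G g (foldr red_cons (a # u) v) = word_eval G g (a # foldr red_cons u v)"
      using word_eval_red_cons[OF g] Cons.prems by simp
    also have "\<dots> = ?y \<otimes> (word_eval G g u \<otimes> word_eval G g v)"
      using Cons by (simp only: step) simp
    also have "\<dots> = word_eval G g (a # u) \<otimes> word_eval G g v"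
      using y word_eval_closed[OF g v] word_eval_closed[OF g, of u] Cons.prems
      by (simp only: step) (simp add: m_assoc)
    finally show ?case .
  qed
  then show "word_eval G g (u \<otimes>\<^bsub>free_group X\<^esub> v) = word_eval G g u \<otimes> word_eval G g v"
    by (simp add: free_group_def)
qed

lemma (in group) word_eval_generator:
  "g x \<in> carrier G \<Longrightarrow> word_eval G g [(x, True)] = g x"
  by (simp add: word_eval_def)

lemma (in group) word_eval_unique:
  assumes h: "h \<in> hom (free_group X) G" and g: "\<And>x. x \<in> X \<Longrightarrow> h [(x, True)] = g x"
    and w: "w \<in> carrier (free_group X)"
  shows "h w = word_eval G g w"
proof -
  let ?F = "free_group X"
  interpret F: group ?F by (rule group_free_group)
  interpret h: group_hom ?F G h
    using h by (simp add: group_hom_def group_hom_axioms_def group_free_group is_group)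
  have letter: "h [(x, b)] = (if b then g x else inv g x)" if x: "x \<in> X" for x b
  proof -
    have c: "[(x, c)] \<in> carrier ?F" for c using x by (simp add: free_group_def)
    have "[(x, False)] \<otimes>\<^bsub>?F\<^esub> [(x, True)] = \<one>\<^bsub>?F\<^esub>" by (simp add: free_group_def)
    then have "inv\<^bsub>?F\<^esub> [(x, True)] = [(x, False)]" using c by (intro F.inv_equality)
    then have "h [(x, False)] = inv h [(x, True)]" using h.hom_inv[OF c[of True]] by simp
    then show ?thesis using g[OF x] by auto
  qed
  show ?thesis using w
  proof (induction w)
    case Nil
    then show ?case using h.hom_one by (simp add: free_group_def word_eval_def)
  next
    case (Cons a w)
    have a: "[a] \<in> carrier ?F" and w: "w \<in> carrier ?F" and aX: "fst a \<in> X"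
      using Cons.prems by (auto simp: free_group_def dest: reduced_ConsD)
    have "a # w = [a] \<otimes>\<^bsub>?F\<^esub> w"
      using Cons.prems by (simp add: free_group_def red_cons_reduced)
    then have "h (a # w) = h [a] \<otimes> h w" using h.hom_mult[OF a w] by simp
    also have "\<dots> = word_eval G g (a # w)"
      using Cons.IH[OF w] letter[OF aX, of "snd a"] by (simp add: word_eval_def case_prod_beta)
    finally show ?case .
  qed
qed

text \<open>Taking the basis inside the type \<open>'a\<close> of group elements is no restriction, since a basis of
  a free group can be chosen as a subset of it.\<close>

definition is_free :: "('a, 'm) monoid_scheme \<Rightarrow> bool" where
  "is_free G \<longleftrightarrow> (\<exists>X :: 'a set. free_group X \<cong> G)"

definition has_nonabelian_free_subgroup :: "('a, 'm) monoid_scheme \<Rightarrow> bool" where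
  "has_nonabelian_free_subgroup G \<longleftrightarrow>
     (\<exists>H. subgroup H G \<and> is_free (G\<lparr>carrier := H\<rparr>) \<and> \<not> comm_group (G\<lparr>carrier := H\<rparr>))"

definition word_length :: "('a, 'm) monoid_scheme \<Rightarrow> 'a set \<Rightarrow> 'a \<Rightarrow> nat" where
  "word_length G S g =
     (LEAST n. \<exists>xs. length xs = n \<and> set xs \<subseteq> S \<union> m_inv G ` S \<and>
                    foldr (\<otimes>\<^bsub>G\<^esub>) xs \<one>\<^bsub>G\<^esub> = g)"

definition free_group_rank :: "nat \<Rightarrow> nat word monoid" where
  "free_group_rank k = free_group {1..k}"

definition tuples :: "('a, 'm) monoid_scheme \<Rightarrow> nat \<Rightarrow> (nat \<Rightarrow> 'a) set" where
  "tuples G k = ({1..k} \<rightarrow>\<^sub>E carrier G)"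

definition is_law :: "('a, 'm) monoid_scheme \<Rightarrow> nat \<Rightarrow> nat word \<Rightarrow> bool" where
  "is_law G k w \<longleftrightarrow>
     w \<in> carrier (free_group_rank k) \<and> w \<noteq> \<one>\<^bsub>free_group_rank k\<^esub> \<and>
     (\<forall>g\<in>tuples G k. word_eval G g w = \<one>\<^bsub>G\<^esub>)"

definition lawless :: "('a, 'm) monoid_scheme \<Rightarrow> bool" where
  "lawless G \<longleftrightarrow> \<not> (\<exists>k w. is_law G k w)"

definition complexity :: "('a, 'm) monoid_scheme \<Rightarrow> 'a set \<Rightarrow> nat \<Rightarrow> nat word \<Rightarrow> nat" where
  "complexity G S k w =
     (LEAST m. \<exists>g\<in>tuples G k. word_eval G g w \<noteq> \<one>\<^bsub>G\<^esub> \<and> m = (\<Sum>i=1..k. word_length G S (g i)))"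

definition lawlessness_growth :: "('a, 'm) monoid_scheme \<Rightarrow> 'a set \<Rightarrow> nat \<Rightarrow> nat \<Rightarrow> nat" where
  "lawlessness_growth G S k n =
     Max {complexity G S k w | w. w \<in> carrier (free_group_rank k) \<and>
                                  w \<noteq> \<one>\<^bsub>free_group_rank k\<^esub> \<and> length w \<le> n}"

text \<open>For \<open>n \<ge> 1\<close> and \<open>k \<ge> 1\<close> the maximum above is over a finite nonempty set.\<close>

lemma lawlessness_growth_set:
  assumes "n \<ge> 1" "k \<ge> 1"
  defines "W \<equiv> {w. w \<in> carrier (free_group_rank k) \<and> w \<noteq> \<one>\<^bsub>free_group_rank k\<^esub> \<and> length w \<le> n}"
  shows "finite W" "W \<noteq> {}"
proof -
  have "W \<subseteq> {w. set w \<subseteq> {1..k} \<times> UNIV \<and> length w \<le> n}"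
    unfolding W_def free_group_rank_def free_group_def by force
  moreover have "finite {w. set w \<subseteq> {1..k} \<times> (UNIV :: bool set) \<and> length w \<le> n}"
    by (rule finite_lists_length_le) simp
  ultimately show "finite W" by (rule finite_subset)
  have "[(1, True)] \<in> W"
    using assms(1,2) by (simp add: W_def free_group_rank_def free_group_def)
  then show "W \<noteq> {}" by blast
qed

end

theory Submission
  imports Defs
begin

text \<open>If \<open>a\<close> and \<open>b\<close> are part of a basis of a free subgroup of \<open>\<Gamma>\<close>, the conjugates \<open>a\<^sup>i b a\<^sup>-\<^sup>i\<close> are
  free, so no nontrivial word of \<open>F\<^sub>k\<close> vanishes at this \<open>k\<close>-tuple, whose total length bounds the
  growth function. Conversely, if the growth function is bounded then every nontrivial word of
  \<open>F\<^sub>k\<close> is nontrivial at some member of one fixed finite set of tuples. Two nontrivial normal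
  subgroups of \<open>F\<^sub>k\<close> intersect nontrivially, as \<open>u\<close> does not commute with every conjugate of \<open>v\<close>;
  hence the evaluation at one of these tuples has trivial kernel and embeds \<open>F\<^sub>k\<close> in \<open>\<Gamma>\<close>.\<close>

section \<open>Inverse words and commutator words without cancellation\<close>

abbreviation inv_word :: "'x word \<Rightarrow> 'x word" where
  "inv_word w \<equiv> rev (map inv_letter w)"

lemma reduced_append:
  "reduced (u @ v) \<longleftrightarrow>
     reduced u \<and> reduced v \<and> (u \<noteq> [] \<longrightarrow> v \<noteq> [] \<longrightarrow> hd v \<noteq> inv_letter (last u))"
proof (induction u rule: reduced.induct)
  case ("2_2" a)
  then show ?case by (cases v) auto
qed auto

lemma inv_letter_eq_iff [simp]: "inv_letter a = inv_letter b \<longleftrightarrow> a = b"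
  by (metis inv_letter_inv_letter)

lemma fst_image_inv_letter [simp]: "fst ` inv_letter ` A = fst ` A"
  by (simp add: image_image)

text \<open>Each generator gives two letters, one for each sign, so fewer than
  \<open>2 * card X\<close> forbidden letters cannot exhaust them.\<close>

lemma ex_letter_avoiding:
  assumes "finite A" "card A < 2 * card X" "finite X"
  shows "\<exists>l :: 'x \<times> bool. fst l \<in> X \<and> l \<notin> A"
proof -
  let ?L = "X \<times> (UNIV :: bool set)"
  have "card ?L = 2 * card X"
    by (simp add: card_cartesian_product)
  then have "\<not> ?L \<subseteq> A"
    using assms card_mono[of A ?L] by auto
  then show ?thesis by fastforce
qed

text \<open>The word is the commutator of \<open>u\<close> with the conjugate of \<open>v\<close> by
  \<open>x\<close>, spelled so that nothing cancels; it is therefore visibly nontrivial. A single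
  letter for \<open>x\<close> might have to avoid four letters at the ends of \<open>u\<close> and
  \<open>v\<close>, which is all there are in rank two. With \<open>x = [p, q]\<close> the task is
  split: \<open>p\<close> takes care of the joints with \<open>u\<close> and its inverse,
  \<open>q\<close> of those with \<open>v\<close> and its inverse.\<close>

lemma ex_reduced_commutator:
  assumes X: "finite X" "card X \<ge> 2"
    and u: "reduced u" "u \<noteq> []" and v: "reduced v" "v \<noteq> []"
  obtains x where "fst ` set x \<subseteq> X"
    "reduced (u @ x @ v @ inv_word x @ inv_word u @ x @ inv_word v @ inv_word x)"
proof -
  have "card {inv_letter (last u), hd u} \<le> 2"
    by (simp add: card_insert_if)
  then have "\<exists>p. fst p \<in> X \<and> p \<notin> {inv_letter (last u), hd u}"
    using X by (intro ex_letter_avoiding) auto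
  then obtain p where p: "fst p \<in> X" "p \<noteq> inv_letter (last u)" "p \<noteq> hd u"
    by blast
  have "card {inv_letter (hd v), last v, inv_letter p} \<le> 3"
    by (simp add: card_insert_if)
  then have "\<exists>q. fst q \<in> X \<and> q \<notin> {inv_letter (hd v), last v, inv_letter p}"
    using X by (intro ex_letter_avoiding) auto
  then obtain q where q: "fst q \<in> X" "q \<noteq> inv_letter (hd v)" "q \<noteq> last v" "q \<noteq> inv_letter p"
    by blast
  have ends: "hd (inv_word w) = inv_letter (last w)" "last (inv_word w) = inv_letter (hd w)"
    if "w \<noteq> []" for w :: "'a word"
    using that by (simp_all add: hd_rev last_rev last_map hd_map)
  define x where "x = [p, q]"
  have x: "reduced x" "x \<noteq> []" "hd x = p" "last x = q" "fst ` set x \<subseteq> X"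
    using p q by (auto simp: x_def)
  have "hd v \<noteq> inv_letter q"
    using q(2) inv_letter_inv_letter[of q] by auto
  then have "reduced (u @ x @ v @ inv_word x @ inv_word u @ x @ inv_word v @ inv_word x)"
    using u v x(1-4) p(2,3) p(2)[symmetric] q(3) q(3)[symmetric]
    by (simp add: reduced_append reduced_inverse ends hd_append)
  then show thesis using that x(5) by blast
qed

section \<open>Evaluating concatenated words, and words in several kernels\<close>

context group begin

lemma word_eval_Cons:
  "word_eval G g (a # w) = (if snd a then g (fst a) else inv g (fst a)) \<otimes> word_eval G g w"
  by (simp add: word_eval_def case_prod_beta)

text \<open>The counterpart of \<open>word_eval_hom\<close> for plain concatenation, the form in
  which the commutators above are written.\<close>

lemma word_eval_append:
  assumes g: "g \<in> X \<rightarrow> carrier G" and "fst ` set u \<subseteq> X" "fst ` set v \<subseteq> X"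
  shows "word_eval G g (u @ v) = word_eval G g u \<otimes> word_eval G g v"
  using assms(2)
proof (induction u)
  case Nil
  then show ?case using word_eval_closed[OF g assms(3)] by (simp add: word_eval_def)
next
  case (Cons a u)
  then have "g (fst a) \<in> carrier G" using g by auto
  then show ?case
    using Cons word_eval_closed[OF g, of u] word_eval_closed[OF g assms(3)]
    by (auto simp: word_eval_Cons m_assoc)
qed

lemma word_eval_inv_word:
  assumes g: "g \<in> X \<rightarrow> carrier G" and "fst ` set u \<subseteq> X"
  shows "word_eval G g (inv_word u) = inv word_eval G g u"
  using assms(2)
proof (induction u)
  case Nil
  then show ?case by (simp add: word_eval_def)
next
  case (Cons a u)
  obtain x b where a: "a = (x, b)" by force
  have x: "g x \<in> carrier G" using g Cons a by auto
  have u: "word_eval G g u \<in> carrier G"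
    using Cons.prems by (intro word_eval_closed[OF g]) auto
  have "word_eval G g (inv_word u @ [inv_letter a])
      = word_eval G g (inv_word u) \<otimes> word_eval G g [inv_letter a]"
    using Cons.prems by (intro word_eval_append[OF g]) auto
  then show ?case
    using Cons x u by (auto simp: a word_eval_def inv_mult_group)
qed

text \<open>If \<open>v\<close> has value one, so does its conjugate by \<open>x\<close>, and a
  commutator is trivial as soon as one of its two entries is.\<close>

lemma word_eval_commutator_eq_one:
  assumes g: "g \<in> X \<rightarrow> carrier G"
    and X: "fst ` set u \<subseteq> X" "fst ` set v \<subseteq> X" "fst ` set x \<subseteq> X"
    and one: "word_eval G g u = \<one> \<or> word_eval G g v = \<one>"
  shows "word_eval G g (u @ x @ v @ inv_word x @ inv_word u @ x @ inv_word v @ inv_word x) = \<one>"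
proof -
  let ?e = "word_eval G g"
  have cl: "?e u \<in> carrier G" "?e v \<in> carrier G" "?e x \<in> carrier G"
    using word_eval_closed[OF g] X by blast+
  have "?e (u @ x @ v @ inv_word x @ inv_word u @ x @ inv_word v @ inv_word x)
     = ?e u \<otimes> (?e x \<otimes> (?e v \<otimes> (inv ?e x \<otimes> (inv ?e u \<otimes> (?e x \<otimes> (inv ?e v \<otimes> inv ?e x))))))"
    using X by (simp add: word_eval_append[OF g] word_eval_inv_word[OF g] image_Un)
  also have "\<dots> = \<one>"
    using one cl by (elim disjE) (simp_all add: m_assoc[symmetric])
  finally show ?thesis .
qed

text \<open>Induction on \<open>T\<close>: a word \<open>u\<close> killed by all earlier tuples and
  a word \<open>v\<close> killed by the new one combine into a commutator killed by all of them. It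
  stays nonempty because it is reduced as spelled and starts with \<open>u\<close>.\<close>

lemma ex_common_kernel_word:
  fixes X :: "'x set"
  assumes X: "finite X" "card X \<ge> 2"
    and T: "finite T" "T \<subseteq> X \<rightarrow> carrier G"
    and ker: "\<And>g. g \<in> T \<Longrightarrow> \<exists>w. reduced w \<and> w \<noteq> [] \<and> fst ` set w \<subseteq> X \<and> word_eval G g w = \<one>"
  shows "\<exists>w. reduced w \<and> w \<noteq> [] \<and> fst ` set w \<subseteq> X \<and> (\<forall>g\<in>T. word_eval G g w = \<one>)"
  using T ker
proof (induction T rule: finite_induct)
  case empty
  \<comment> \<open>For no tuples any nonempty reduced word will do; one letter suffices.\<close>
  obtain l :: "'x \<times> bool" where "fst l \<in> X" using ex_letter_avoiding[of "{}" X] X by auto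
  then show ?case by (intro exI[of _ "[l]"]) simp
next
  case (insert g T)
  obtain u where u: "reduced u" "u \<noteq> []" "fst ` set u \<subseteq> X" "\<forall>g\<in>T. word_eval G g u = \<one>"
    using insert by auto
  obtain v where v: "reduced v" "v \<noteq> []" "fst ` set v \<subseteq> X" "word_eval G g v = \<one>"
    using insert.prems(2)[of g] by auto
  obtain x where x: "fst ` set x \<subseteq> X"
    and red: "reduced (u @ x @ v @ inv_word x @ inv_word u @ x @ inv_word v @ inv_word x)"
    using ex_reduced_commutator[OF X u(1,2) v(1,2)] .
  let ?w = "u @ x @ v @ inv_word x @ inv_word u @ x @ inv_word v @ inv_word x"
  have "word_eval G h ?w = \<one>" if "h \<in> insert g T" for h
    using that insert.prems(1) u v x by (intro word_eval_commutator_eq_one[of h X]) auto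
  moreover have "fst ` set ?w \<subseteq> X" using u v x by auto
  ultimately show ?case using red u(2) by (intro exI[of _ ?w]) blast
qed

section \<open>Word length and finiteness of balls\<close>

lemma ex_word:
  assumes S: "S \<subseteq> carrier G" and "g \<in> generate G S"
  shows "\<exists>xs. set xs \<subseteq> S \<union> m_inv G ` S \<and> foldr (\<otimes>) xs \<one> = g"
  using assms(2)
proof (induction rule: generate.induct)
  case one
  show ?case by (intro exI[of _ "[]"]) simp
next
  case (incl h)
  then show ?case using S by (intro exI[of _ "[h]"]) auto
next
  case (inv h)
  then show ?case using S by (intro exI[of _ "[inv h]"]) auto
next
  case (eng h1 h2)
  then obtain xs ys where xs: "set xs \<subseteq> S \<union> m_inv G ` S" "foldr (\<otimes>) xs \<one> = h1"
    and ys: "set ys \<subseteq> S \<union> m_inv G ` S" "foldr (\<otimes>) ys \<one> = h2" by blast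
  have cl: "foldr (\<otimes>) zs \<one> \<in> carrier G" if "set zs \<subseteq> carrier G" for zs
    using that by (induction zs) auto
  have ys_cl: "set ys \<subseteq> carrier G" using ys(1) S by auto
  have "set xs \<subseteq> carrier G" using xs(1) S by auto
  then have "foldr (\<otimes>) (xs @ ys) \<one> = foldr (\<otimes>) xs \<one> \<otimes> foldr (\<otimes>) ys \<one>"
    using cl[OF ys_cl] by (induction xs) (auto simp: m_assoc cl)
  then show ?case using xs ys by (intro exI[of _ "xs @ ys"]) auto
qed

text \<open>Each element of the ball is the product of a list of at most \<open>C\<close> letters
  from a finite alphabet, and there are finitely many such lists.\<close>

lemma finite_ball:
  assumes "finite S" "S \<subseteq> carrier G" "generate G S = carrier G"
  shows "finite {g \<in> carrier G. word_length G S g \<le> C}"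
proof -
  let ?L = "{xs. set xs \<subseteq> S \<union> m_inv G ` S \<and> length xs \<le> C}"
  have "{g \<in> carrier G. word_length G S g \<le> C} \<subseteq> (\<lambda>xs. foldr (\<otimes>) xs \<one>) ` ?L"
  proof
    fix g assume g: "g \<in> {g \<in> carrier G. word_length G S g \<le> C}"
    let ?P = "\<lambda>n. \<exists>xs. length xs = n \<and> set xs \<subseteq> S \<union> m_inv G ` S \<and> foldr (\<otimes>) xs \<one> = g"
    \<comment> \<open>Since \<open>S\<close> generates, the minimum in \<open>word_length\<close> is
      over a nonempty set and hence attained.\<close>
    have "\<exists>n. ?P n" using ex_word[OF assms(2), of g] g assms(3) by auto
    then have "?P (word_length G S g)" unfolding word_length_def by (rule LeastI_ex)
    then show "g \<in> (\<lambda>xs. foldr (\<otimes>) xs \<one>) ` ?L" using g by force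
  qed
  moreover have "finite ?L" using assms(1) by (intro finite_lists_length_le) simp
  ultimately show ?thesis by (meson finite_imageI finite_subset)
qed

section \<open>Free subgroups from tuples without relations\<close>

lemma has_nonabelian_free_subgroupI:
  assumes g: "g \<in> I \<rightarrow> carrier G" and ij: "i \<in> I" "j \<in> I" "i \<noteq> j"
    and ker: "\<And>w. reduced w \<Longrightarrow> w \<noteq> [] \<Longrightarrow> fst ` set w \<subseteq> I \<Longrightarrow> word_eval G g w \<noteq> \<one>"
  shows "has_nonabelian_free_subgroup G"
proof -
  \<comment> \<open>\<open>is_free\<close> asks for a basis inside the type of group elements, so
    the entries of the tuple replace the indices as basis.\<close>
  define X where "X = g ` I"
  let ?F = "free_group X" and ?f = "word_eval G (\<lambda>x. x)" and ?\<sigma> = "inv_into I g"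
  have X: "(\<lambda>x. x) \<in> X \<rightarrow> carrier G" using g by (auto simp: X_def)
  interpret F: group ?F by (rule group_free_group)
  interpret f: group_hom ?F G ?f
    using word_eval_hom[OF X] by unfold_locales
  have \<sigma>: "?\<sigma> x \<in> I" "g (?\<sigma> x) = x" if "x \<in> X" for x
    using that by (auto simp: X_def inv_into_into f_inv_into_f)
  \<comment> \<open>Relabels words over \<open>X\<close> as words over \<open>I\<close>, where
    \<open>ker\<close> applies, choosing one index for each entry.\<close>
  let ?m = "map (\<lambda>(x, b). (?\<sigma> x, b))"
  have eval: "word_eval G g (?m w) = ?f w" if "fst ` set w \<subseteq> X" for w
    using that by (induction w) (auto simp: word_eval_def \<sigma>)
  \<comment> \<open>On \<open>X\<close> the choice of index has \<open>g\<close> as a left inverse,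
    so relabelling is injective and creates no cancelling pair.\<close>
  have red: "reduced (?m w)" if "reduced w" "fst ` set w \<subseteq> X" for w
    using that
  proof (induction w rule: reduced.induct)
    case (1 a b w)
    then show ?case by (cases a; cases b) (auto dest!: arg_cong[where f = g] simp: \<sigma>)
  qed auto
  have "w = []" if w: "w \<in> carrier ?F" "?f w = \<one>" for w
  proof (rule ccontr)
    assume "w \<noteq> []"
    moreover have "fst ` set (?m w) \<subseteq> I" using w \<sigma>(1) by (force simp: free_group_def)
    ultimately have "word_eval G g (?m w) \<noteq> \<one>"
      using w red[of w] ker[of "?m w"] by (auto simp: free_group_def)
    then show False using eval[of w] w by (auto simp: free_group_def)
  qed
  then have "inj_on ?f (carrier ?F)"
    by (intro f.inj_iff_trivial_ker[THEN iffD2])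
       (auto simp: kernel_def free_group_def word_eval_def)
  moreover define H where "H = ?f ` carrier ?F"
  ultimately have "?f \<in> iso ?F (G\<lparr>carrier := H\<rparr>)"
    using f.homh by (auto simp: iso_def hom_def bij_betw_def)
  then have free: "is_free (G\<lparr>carrier := H\<rparr>)"
    unfolding is_free_def is_iso_def by blast
  have mem: "g l \<in> H" if "l \<in> I" for l
  proof -
    have "?f [(g l, True)] = g l" using that g by (intro word_eval_generator) auto
    moreover have "[(g l, True)] \<in> carrier ?F" using that by (simp add: free_group_def X_def)
    ultimately show ?thesis unfolding H_def by (metis imageI)
  qed
  have cl: "g i \<in> carrier G" "g j \<in> carrier G" using ij g by auto
  \<comment> \<open>The commutator of the generators \<open>i\<close> and \<open>j\<close> is a
    nonempty reduced word, so \<open>g i\<close> and \<open>g j\<close> do not commute.\<close>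
  have "word_eval G g [(i, True), (j, True), (i, False), (j, False)] \<noteq> \<one>"
    using ij by (intro ker) auto
  then have "g i \<otimes> (g j \<otimes> (inv g i \<otimes> inv g j)) \<noteq> \<one>"
    using cl by (simp add: word_eval_def)
  moreover have "g i \<otimes> (g j \<otimes> (inv g i \<otimes> inv g j)) = (g i \<otimes> g j) \<otimes> inv (g j \<otimes> g i)"
    using cl by (simp add: m_assoc inv_mult_group)
  ultimately have "g i \<otimes> g j \<noteq> g j \<otimes> g i" using cl by auto
  then have "\<not> comm_group (G\<lparr>carrier := H\<rparr>)"
    using mem ij comm_groupE(4)[of "G\<lparr>carrier := H\<rparr>" "g i" "g j"] by auto
  moreover have "subgroup H G" unfolding H_def by (rule f.img_is_subgroup)
  ultimately show ?thesis using free unfolding has_nonabelian_free_subgroup_def by blast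
qed

end

section \<open>Noncommutative free groups and their free families of conjugates\<close>

lemma inv_free_group:
  assumes "w \<in> carrier (free_group X)"
  shows "inv\<^bsub>free_group X\<^esub> w = inv_word w"
proof -
  interpret group "free_group X" by (rule group_free_group)
  show ?thesis
    using assms foldr_inverse[of "[]" w]
    by (intro inv_equality) (auto simp: free_group_def foldr_Nil reduced_inverse)
qed

text \<open>The two letters are equal or mutually inverse; in the latter case both sides are
  \<open>w\<close>.\<close>

lemma red_cons_commute:
  assumes "reduced w" "fst a = fst b"
  shows "red_cons a (red_cons b w) = red_cons b (red_cons a w)"
proof -
  have "b = a \<or> b = inv_letter a" using assms(2) by (cases a; cases b) auto
  then show ?thesis
    using red_cons_inv[OF assms(1), of a] red_cons_inv[OF assms(1), of "inv_letter a"] by auto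
qed

text \<open>Used in contrapositive form: a noncommutative free group has two distinct basis
  elements.\<close>

lemma comm_group_free_group:
  assumes "\<And>x y. x \<in> X \<Longrightarrow> y \<in> X \<Longrightarrow> x = y"
  shows "comm_group (free_group X)"
proof (rule group.group_comm_groupI[OF group_free_group])
  fix u v assume uv: "u \<in> carrier (free_group X)" "v \<in> carrier (free_group X)"
  have one: "red_cons a (foldr red_cons t w) = foldr red_cons t (red_cons a w)"
    if "fst a \<in> X" "fst ` set t \<subseteq> X" "reduced w" for a t w
    using that(2)
  proof (induction t)
    case (Cons b t)
    then have "fst a = fst b" using assms that(1) by auto
    then have "red_cons a (red_cons b (foldr red_cons t w))
        = red_cons b (red_cons a (foldr red_cons t w))"
      using that(3) by (intro red_cons_commute reduced_foldr)
    then show ?case using Cons by simp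
  qed simp
  have commute: "foldr red_cons s (foldr red_cons t []) = foldr red_cons t (foldr red_cons s [])"
    if "fst ` set s \<subseteq> X" "fst ` set t \<subseteq> X" for s t
    using that by (induction s) (simp_all add: one reduced_foldr)
  then show "u \<otimes>\<^bsub>free_group X\<^esub> v = v \<otimes>\<^bsub>free_group X\<^esub> u"
    using uv commute[of u v] foldr_Nil[of u] foldr_Nil[of v] by (simp add: free_group_def)
qed

text \<open>Opposite powers of \<open>a\<close> cancel until one is used up, and \<open>b\<close>, a
  letter over another generator, stops the cancellation. For \<open>j = 0\<close> nothing cancels
  and the product is the concatenation.\<close>

lemma foldr_red_cons_replicate:
  assumes "fst b \<noteq> a"
  shows "foldr red_cons (replicate i (a, e)) (replicate j (a, \<not> e) @ b # r) =
    (if i \<le> j then replicate (j - i) (a, \<not> e) else replicate (i - j) (a, e)) @ b # r"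
proof (induction i)
  case (Suc i)
  show ?case
  proof (cases "i < j")
    case True
    then have "replicate (j - i) (a, \<not> e) = (a, \<not> e) # replicate (j - Suc i) (a, \<not> e)"
      by (metis Suc_diff_Suc replicate_Suc)
    then show ?thesis using Suc True by simp
  next
    case False
    show ?thesis
    proof (cases "i = j")
      case True
      then show ?thesis using Suc assms by auto
    next
      case neq: False
      then have "Suc i - j = Suc (i - j)" "i - j = Suc (i - j - 1)" using False by auto
      moreover have "replicate (i - j) (a, e) = (a, e) # replicate (i - j - 1) (a, e)"
        using calculation(2) by (metis replicate_Suc)
      ultimately show ?thesis using Suc False neq by simp
    qed
  qed
qed simp

lemma reduced_replicate: "reduced (replicate n a)"
proof (induction n)
  case (Suc n)
  then show ?case by (cases n) auto
qed simp

text \<open>For distinct \<open>a\<close> and \<open>b\<close> this family is free, which turns two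
  basis elements into free tuples of any length.\<close>

definition conj_power :: "'x \<Rightarrow> 'x \<Rightarrow> nat \<Rightarrow> 'x word" where
  "conj_power a b i = replicate i (a, True) @ (b, True) # replicate i (a, False)"

lemma conj_power_closed:
  assumes "a \<in> X" "b \<in> X" "a \<noteq> b"
  shows "conj_power a b i \<in> carrier (free_group X)"
  using assms
  by (auto simp: conj_power_def free_group_def reduced_append reduced_replicate
      reduced_append[of "[(b, True)]", simplified])

text \<open>Multiplying \<open>a^i b^e a^-i\<close> by a value starting with \<open>a^j b^f\<close>
  never destroys \<open>b^e\<close>: for different \<open>i\<close> and \<open>j\<close> a nonzero
  power of \<open>a\<close> remains between the two \<open>b\<close>-letters, and for
  \<open>i = j\<close> reducedness forces \<open>f = e\<close>. Keeping the exact prefix in the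
  statement makes the induction work.\<close>

lemma word_eval_conj_power_prefix:
  assumes ab: "a \<in> X" "b \<in> X" "a \<noteq> b" and "reduced ((i, e) # w)"
  shows "\<exists>r. word_eval (free_group X) (conj_power a b) ((i, e) # w)
             = replicate i (a, True) @ (b, e) # r"
  using assms(4)
proof (induction w arbitrary: i e)
  interpret group "free_group X" by (rule group_free_group)
  \<comment> \<open>Inverting the conjugate only changes the sign of its middle letter, so both
    signs \<open>e\<close> have the same shape.\<close>
  have step: "word_eval (free_group X) (conj_power a b) ((i, e) # w) =
      foldr red_cons (replicate i (a, True))
        (red_cons (b, e) (foldr red_cons (replicate i (a, False))
          (word_eval (free_group X) (conj_power a b) w)))" for i e w
    by (simp add: word_eval_Cons inv_free_group conj_power_closed ab)
       (simp add: free_group_def conj_power_def)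
  have outer: "foldr red_cons (replicate i (a, True)) ((b, e) # r)
      = replicate i (a, True) @ (b, e) # r" for i e r
    using foldr_red_cons_replicate[of "(b, e)" a i True 0 r] ab by (cases i) auto
  {
    case Nil
    have "foldr red_cons (replicate i (a, False)) [] = replicate i (a, False)"
      by (intro foldr_Nil reduced_replicate)
    moreover have "red_cons (b, e) (replicate i (a, False)) = (b, e) # replicate i (a, False)"
      using ab by (cases i) auto
    moreover have "word_eval (free_group X) (conj_power a b) [] = []"
      by (simp add: word_eval_def free_group_def)
    ultimately show ?case by (simp only: step outer) blast
  next
    case (Cons c w)
    obtain j f where c: "c = (j, f)" by force
    obtain r where r: "word_eval (free_group X) (conj_power a b) (c # w)
        = replicate j (a, True) @ (b, f) # r"
      using Cons by (auto simp: c)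
    define t where "t = (if i \<le> j then replicate (j - i) (a, True) else replicate (i - j) (a, False))
        @ (b, f) # r"
    have "foldr red_cons (replicate i (a, False)) (replicate j (a, True) @ (b, f) # r) = t"
      using foldr_red_cons_replicate[of "(b, f)" a i False j r] ab by (simp add: t_def)
    moreover have "red_cons (b, e) t = (b, e) # t"
    proof (cases "i = j")
      case True
      then show ?thesis using Cons.prems by (auto simp: t_def c)
    next
      case False
      then have "\<exists>s l. t = (a, l) # s"
        by (cases "j - i"; cases "i - j") (auto simp: t_def)
      then show ?thesis using ab by auto
    qed
    ultimately show ?case by (simp only: step r outer) blast
  }
qed

lemma free_tuple_in_free_group:
  assumes "a \<in> X" "b \<in> X" "a \<noteq> b" "reduced w" "w \<noteq> []"
  shows "word_eval (free_group X) (conj_power a b) w \<noteq> \<one>\<^bsub>free_group X\<^esub>"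
proof -
  obtain i e v where w: "w = (i, e) # v" using assms(5) by (metis list.exhaust surj_pair)
  show ?thesis
    using word_eval_conj_power_prefix[OF assms(1-3), of i e v] assms(4)
    by (auto simp: w free_group_def)
qed

text \<open>The free family of conjugates is carried into \<open>G\<close> along an injective
  homomorphism, which preserves nontrivial values.\<close>

lemma (in group) ex_free_tuple:
  assumes "has_nonabelian_free_subgroup G"
  obtains g where "g \<in> I \<rightarrow>\<^sub>E carrier G"
    "\<And>w. reduced w \<Longrightarrow> w \<noteq> [] \<Longrightarrow> fst ` set w \<subseteq> (I :: nat set) \<Longrightarrow> word_eval G g w \<noteq> \<one>"
proof -
  obtain H X where H: "subgroup H G" "\<not> comm_group (G\<lparr>carrier := H\<rparr>)"
    and "free_group (X :: 'a set) \<cong> G\<lparr>carrier := H\<rparr>"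
    using assms by (auto simp: has_nonabelian_free_subgroup_def is_free_def)
  then obtain \<phi> where \<phi>: "\<phi> \<in> iso (free_group X) (G\<lparr>carrier := H\<rparr>)"
    by (auto simp: is_iso_def)
  have "\<not> comm_group (free_group X)"
    using H \<phi> comm_group.iso_imp_comm_group[of "free_group X" "G\<lparr>carrier := H\<rparr>"]
      subgroup.subgroup_is_group[OF H(1)] is_group
    by (auto simp: is_iso_def group.is_monoid)
  then obtain a b where ab: "a \<in> X" "b \<in> X" "a \<noteq> b"
    using comm_group_free_group by metis
  let ?F = "free_group X" and ?h = "conj_power a b"
  interpret F: group ?F by (rule group_free_group)
  have hom: "\<phi> \<in> hom ?F G"
    using \<phi> subgroup.subset[OF H(1)] by (auto simp: iso_def hom_def Pi_iff)
  interpret \<phi>: group_hom ?F G \<phi>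
    using hom by unfold_locales
  have inj: "inj_on \<phi> (carrier ?F)" using \<phi> by (simp add: iso_def bij_betw_def)
  have h: "?h \<in> I \<rightarrow> carrier ?F" using conj_power_closed ab by auto
  \<comment> \<open>Restricted to \<open>I\<close> because tuples are extensional functions.\<close>
  define g where "g = (\<lambda>i\<in>I. \<phi> (?h i))"
  have g: "g \<in> I \<rightarrow>\<^sub>E carrier G" using h hom by (auto simp: g_def hom_def Pi_iff)
  have "word_eval G g w \<noteq> \<one>" if w: "reduced w" "w \<noteq> []" "fst ` set w \<subseteq> I" for w
  proof -
    have wF: "w \<in> carrier (free_group I)" using w by (simp add: free_group_def)
    \<comment> \<open>Both sides are homomorphisms on the free group on \<open>I\<close> that agree
      on the generators.\<close>
    have "(\<phi> \<circ> word_eval ?F ?h) w = word_eval G g w"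
    proof (rule word_eval_unique[OF _ _ wF])
      show "\<phi> \<circ> word_eval ?F ?h \<in> hom (free_group I) G"
        using F.word_eval_hom[OF h] hom by (auto simp: hom_def Pi_iff)
      show "(\<phi> \<circ> word_eval ?F ?h) [(i, True)] = g i" if "i \<in> I" for i
        using that funcset_mem[OF h that] F.word_eval_generator[of ?h i] by (simp add: g_def)
    qed
    moreover have "word_eval ?F ?h w \<in> carrier ?F"
      using F.word_eval_closed[OF h] w by simp
    moreover have "word_eval ?F ?h w \<noteq> \<one>\<^bsub>?F\<^esub>"
      using free_tuple_in_free_group[OF ab] w by simp
    ultimately show ?thesis
      using inj_onD[OF inj, of "word_eval ?F ?h w" "\<one>\<^bsub>?F\<^esub>"] by auto
  qed
  then show thesis using that g by blast
qed

section \<open>Complexity and boundedness of the growth function\<close>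

lemma complexity_le:
  assumes "g \<in> tuples G k" "word_eval G g w \<noteq> \<one>\<^bsub>G\<^esub>"
  shows "complexity G S k w \<le> (\<Sum>i=1..k. word_length G S (g i))"
  unfolding complexity_def using assms by (intro Least_le) blast

text \<open>Lawlessness provides a tuple at which \<open>w\<close> is nontrivial, so the minimum is
  over a nonempty set.\<close>

lemma complexity_attained:
  assumes "lawless G" "w \<in> carrier (free_group_rank k)" "w \<noteq> \<one>\<^bsub>free_group_rank k\<^esub>"
  obtains g where "g \<in> tuples G k" "word_eval G g w \<noteq> \<one>\<^bsub>G\<^esub>"
    "complexity G S k w = (\<Sum>i=1..k. word_length G S (g i))"
proof -
  let ?P = "\<lambda>m. \<exists>g\<in>tuples G k. word_eval G g w \<noteq> \<one>\<^bsub>G\<^esub> \<and> m = (\<Sum>i=1..k. word_length G S (g i))"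
  have "\<exists>m. ?P m" using assms unfolding lawless_def is_law_def by blast
  then have "?P (complexity G S k w)" unfolding complexity_def by (rule LeastI_ex)
  then show thesis using that by blast
qed

lemma carrier_free_group_rank:
  "w \<in> carrier (free_group_rank k) \<longleftrightarrow> reduced w \<and> fst ` set w \<subseteq> {1..k}"
  "\<one>\<^bsub>free_group_rank k\<^esub> = []"
  by (simp_all add: free_group_rank_def free_group_def)

text \<open>Every nontrivial word takes part in the maximum at its own length, so a bound on all the
  maxima is a bound on all complexities.\<close>

lemma bdd_above_lawlessness_growth_iff:
  assumes "k \<ge> 1"
  shows "bdd_above (lawlessness_growth G S k ` {1..}) \<longleftrightarrow>
    (\<exists>C. \<forall>w\<in>carrier (free_group_rank k). w \<noteq> [] \<longrightarrow> complexity G S k w \<le> C)"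
proof -
  let ?W = "\<lambda>n. {w. w \<in> carrier (free_group_rank k) \<and> w \<noteq> \<one>\<^bsub>free_group_rank k\<^esub> \<and> length w \<le> n}"
  have growth: "lawlessness_growth G S k n = Max (complexity G S k ` ?W n)" for n
    unfolding lawlessness_growth_def by (rule arg_cong[where f = Max]) auto
  \<comment> \<open>For \<open>n = 0\<close> there would be no words and \<open>Max\<close> would be
    unspecified; from \<open>n = 1\<close> on it is a true maximum.\<close>
  have le: "lawlessness_growth G S k n \<le> C \<longleftrightarrow> (\<forall>w\<in>?W n. complexity G S k w \<le> C)"
    if "n \<ge> 1" for n C
    unfolding growth using lawlessness_growth_set[OF that assms] by (subst Max_le_iff) auto
  have "(\<forall>n\<in>{1..}. lawlessness_growth G S k n \<le> C) \<longleftrightarrow>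
      (\<forall>w\<in>carrier (free_group_rank k). w \<noteq> [] \<longrightarrow> complexity G S k w \<le> C)" for C
  proof
    assume C: "\<forall>n\<in>{1..}. lawlessness_growth G S k n \<le> C"
    show "\<forall>w\<in>carrier (free_group_rank k). w \<noteq> [] \<longrightarrow> complexity G S k w \<le> C"
    proof (intro ballI impI)
      fix w assume "w \<in> carrier (free_group_rank k)" "w \<noteq> []"
      then have "length w \<ge> 1" "w \<in> ?W (length w)"
        by (simp_all add: carrier_free_group_rank(2) Suc_leI)
      then show "complexity G S k w \<le> C" using C le by (meson atLeast_iff)
    qed
  qed (simp add: le carrier_free_group_rank(2))
  then show ?thesis unfolding bdd_above_def ball_simps by simp
qed

theorem theorem1p1:
  fixes G :: "('a, 'm) monoid_scheme" and S :: "'a set" and k :: nat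
  assumes "group G"
    and "finite S" and "S \<subseteq> carrier G" and "generate G S = carrier G"
    and "lawless G"
    and "k \<ge> 2"
  shows "has_nonabelian_free_subgroup G \<longleftrightarrow> bdd_above (lawlessness_growth G S k ` {1..})"
proof -
  interpret group G by fact
  have growth: "bdd_above (lawlessness_growth G S k ` {1..}) \<longleftrightarrow>
    (\<exists>C. \<forall>w\<in>carrier (free_group_rank k). w \<noteq> [] \<longrightarrow> complexity G S k w \<le> C)"
    using assms(6) by (intro bdd_above_lawlessness_growth_iff) simp
  show ?thesis unfolding growth
  proof
    assume "has_nonabelian_free_subgroup G"
    then obtain g where g: "g \<in> tuples G k"
      "\<And>w. w \<in> carrier (free_group_rank k) \<Longrightarrow> w \<noteq> [] \<Longrightarrow> word_eval G g w \<noteq> \<one>\<^bsub>G\<^esub>"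
      using ex_free_tuple[of "{1..k}"] unfolding tuples_def carrier_free_group_rank(1) by metis
    \<comment> \<open>The total word length of this one tuple serves as \<open>C\<close> for every
      word.\<close>
    then show "\<exists>C. \<forall>w\<in>carrier (free_group_rank k). w \<noteq> [] \<longrightarrow> complexity G S k w \<le> C"
      using complexity_le by blast
  next
    assume "\<exists>C. \<forall>w\<in>carrier (free_group_rank k). w \<noteq> [] \<longrightarrow> complexity G S k w \<le> C"
    then obtain C where
      C: "\<And>w. w \<in> carrier (free_group_rank k) \<Longrightarrow> w \<noteq> [] \<Longrightarrow> complexity G S k w \<le> C" by blast
    \<comment> \<open>The entries are bounded separately by \<open>C\<close>: this finite set
      contains every tuple of total length at most \<open>C\<close>.\<close>
    define T where "T = {1..k} \<rightarrow>\<^sub>E {g \<in> carrier G. word_length G S g \<le> C}"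
    have T: "finite T" "T \<subseteq> {1..k} \<rightarrow> carrier G"
      unfolding T_def using finite_ball[OF assms(2-4)] by (auto intro!: finite_PiE)
    have "\<not> (\<exists>w. reduced w \<and> w \<noteq> [] \<and> fst ` set w \<subseteq> {1..k} \<and> (\<forall>g\<in>T. word_eval G g w = \<one>\<^bsub>G\<^esub>))"
    proof clarify
      fix w :: "nat word"
      assume w: "reduced w" "w \<noteq> []" "fst ` set w \<subseteq> {1..k}" "\<forall>g\<in>T. word_eval G g w = \<one>\<^bsub>G\<^esub>"
      then have wF: "w \<in> carrier (free_group_rank k)" "w \<noteq> \<one>\<^bsub>free_group_rank k\<^esub>"
        by (simp_all add: carrier_free_group_rank)
      obtain g where g: "g \<in> tuples G k" "word_eval G g w \<noteq> \<one>\<^bsub>G\<^esub>"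
        "complexity G S k w = (\<Sum>i=1..k. word_length G S (g i))"
        using complexity_attained[OF assms(5) wF] .
      have "word_length G S (g i) \<le> C" if "i \<in> {1..k}" for i
        using member_le_sum[OF that, of "\<lambda>i. word_length G S (g i)"] g(3) C[OF wF(1) w(2)] by simp
      then have "g \<in> T" using g(1) by (auto simp: T_def tuples_def)
      then show False using w(4) g(2) by blast
    qed
    moreover have "2 \<le> card {1..k}" using assms(6) by simp
    \<comment> \<open>If every tuple in \<open>T\<close> killed some nontrivial word, one nontrivial
      word would be killed by all of them.\<close>
    ultimately obtain g where g: "g \<in> T"
      "\<And>w. reduced w \<Longrightarrow> w \<noteq> [] \<Longrightarrow> fst ` set w \<subseteq> {1..k} \<Longrightarrow> word_eval G g w \<noteq> \<one>\<^bsub>G\<^esub>"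
      using ex_common_kernel_word[OF finite_atLeastAtMost _ T] by blast
    then show "has_nonabelian_free_subgroup G"
      using T(2) assms(6) by (intro has_nonabelian_free_subgroupI[of g "{1..k}" 1 2]) auto
  qed
qed

end
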